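(* Let $\alpha_1,\alpha_2,\beta_1,\beta_2,\gamma_1,\gamma_2\in\mathbb{C}$ and let $TSV=\mathbb{C}[\partial]L\oplus\mathbb{C}[\partial]M\oplus\mathbb{C}[\partial]Y$ be the free $\mathbb{C}[\partial]$-module of rank 3 with basis $L,M,Y$, with the $\lambda$-brackets $$[L_\lambda L]=(\partial+2\lambda)L,\quad [L_\lambda Y]=(\partial+\alpha_1\lambda+\alpha_2)Y,\quad [L_\lambda M]=(\partial+\beta_1\lambda+\beta_2)M,$$ $$[Y_\lambda Y]=(\partial+\gamma_1\lambda+\gamma_2)M,\quad [Y_\lambda M]=[M_\lambda M]=0.$$ Then $TSV$ is a Lie conformal algebra with these $\lambda$-brackets if and only if $\gamma_1=2$, $\gamma_2=0$, $\beta_2=2\alpha_2$ and $\beta_1=2(\alpha_1-1)$.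
   Context: A Lie conformal algebra $R$ is a $\mathbb{C}[\partial]$-module with a $\mathbb{C}$-bilinear $\lambda$-bracket $[\cdot_\lambda\cdot]:R\otimes R\to R[\lambda]=R\otimes\mathbb{C}[\lambda]$ such that for all $a,b,c\in R$: (conformal sesquilinearity) $[\partial a_\lambda b]=-\lambda[a_\lambda b]$, $[a_\lambda\partial b]=(\lambda+\partial)[a_\lambda b]$; (skew-symmetry) $[a_\lambda b]=-[b_{-\lambda-\partial}a]$; (Jacobi identity) $[a_\lambda[b_\mu c]]=[[a_\lambda b]_{\lambda+\mu}c]+[b_\mu[a_\lambda c]]$. Convention: the brackets of basis elements not listed, namely $[Y_\lambda L]$, $[M_\lambda L]$, $[M_\lambda Y]$, are defined from the listed ones by skew-symmetry, and the bracket is extended to all of $TSV$ by conformal sesquilinearity. *)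

theory Defs
  imports "HOL-Analysis.Finite_Cartesian_Product" "HOL-Computational_Algebra.Polynomial"
begin

section \<open>Lie conformal algebras\<close>

text \<open>
  A \<open>\<complex>[\<partial>]\<close>-module is a type with a scalar multiplication by \<^typ>\<open>complex poly\<close>
  (\<^locale>\<open>module\<close>); the polynomial \<open>[:0, 1:]\<close> is \<open>\<partial>\<close> and \<open>[:c:]\<close> is the complex scalar \<open>c\<close>.
  \<open>R[\<lambda>]\<close> is \<open>'a poly\<close>, where multiplication by \<open>\<lambda>\<close> is \<open>pCons 0\<close>.
  \<open>R[\<lambda>, \<mu>]\<close> is \<open>'a poly poly\<close>: the outer variable is \<open>\<mu>\<close>, the inner one is \<open>\<lambda>\<close>.
\<close>

text \<open>
  \<open>poly_subst \<iota> T f\<close> replaces the variable of \<open>f = \<Sum>\<^sub>k x\<^sub>k \<nu>\<^sup>k\<close> by the operator \<open>T\<close>,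
  which acts from the left: \<open>\<Sum>\<^sub>k T\<^sup>k (\<iota> x\<^sub>k)\<close>.
\<close>

definition poly_subst :: "('a::zero \<Rightarrow> 'b::comm_monoid_add) \<Rightarrow> ('b \<Rightarrow> 'b) \<Rightarrow> 'a poly \<Rightarrow> 'b" where
  "poly_subst \<iota> T f = (\<Sum>k\<le>degree f. (T ^^ k) (\<iota> (coeff f k)))"

definition coeff_scale ::
    "(complex poly \<Rightarrow> 'a \<Rightarrow> 'a) \<Rightarrow> complex poly \<Rightarrow> 'a::ab_group_add poly \<Rightarrow> 'a poly" where
  "coeff_scale smul p = map_poly (smul p)"

text \<open>\<open>f(\<lambda>) \<mapsto> f(-\<lambda> - \<partial>)\<close>, with the powers of \<open>-\<lambda> - \<partial>\<close> to the left of the coefficients.\<close>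

definition subst_skew ::
    "(complex poly \<Rightarrow> 'a \<Rightarrow> 'a) \<Rightarrow> 'a::ab_group_add poly \<Rightarrow> 'a poly" where
  "subst_skew smul =
     poly_subst (\<lambda>x. [:x:]) (\<lambda>g. - pCons 0 g - coeff_scale smul [:0, 1:] g)"

definition mul_lambda :: "'a::ab_group_add poly poly \<Rightarrow> 'a poly poly" where
  "mul_lambda = map_poly (pCons 0)"

definition mul_mu :: "'a::ab_group_add poly poly \<Rightarrow> 'a poly poly" where
  "mul_mu = pCons 0"

definition in_lambda :: "'a::ab_group_add poly \<Rightarrow> 'a poly poly" where
  "in_lambda g = [:g:]"

definition in_mu :: "'a::ab_group_add poly \<Rightarrow> 'a poly poly" where
  "in_mu = map_poly (\<lambda>x. [:x:])"

definition in_lambda_plus_mu :: "'a::ab_group_add poly \<Rightarrow> 'a poly poly" where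
  "in_lambda_plus_mu = poly_subst (\<lambda>x. [:[:x:]:]) (\<lambda>g. mul_lambda g + mul_mu g)"

locale lie_conformal_algebra = module smul
  for smul :: "complex poly \<Rightarrow> 'a::ab_group_add \<Rightarrow> 'a" +
  fixes bracket :: "'a \<Rightarrow> 'a \<Rightarrow> 'a poly"
  assumes bracket_add_left: "bracket (a + b) c = bracket a c + bracket b c"
    and bracket_add_right: "bracket a (b + c) = bracket a b + bracket a c"
    and bracket_scale_left: "bracket (smul [:z:] a) b = coeff_scale smul [:z:] (bracket a b)"
    and bracket_scale_right: "bracket a (smul [:z:] b) = coeff_scale smul [:z:] (bracket a b)"
    and sesquilinear_left: "bracket (smul [:0, 1:] a) b = - pCons 0 (bracket a b)"
    and sesquilinear_right:
      "bracket a (smul [:0, 1:] b)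
         = pCons 0 (bracket a b) + coeff_scale smul [:0, 1:] (bracket a b)"
    and skew_symmetry: "bracket a b = - subst_skew smul (bracket b a)"
    and jacobi:
      "poly_subst (\<lambda>x. in_lambda (bracket a x)) mul_mu (bracket b c)
         = poly_subst (\<lambda>x. in_lambda_plus_mu (bracket x c)) mul_lambda (bracket a b)
         + poly_subst (\<lambda>x. in_mu (bracket b x)) mul_lambda (bracket a c)"

section \<open>The module \<open>TSV\<close> and its brackets\<close>

datatype tsv_gen = L | M | Y

lemma UNIV_tsv_gen: "UNIV = {L, M, Y}"
  using tsv_gen.exhaust by auto

instance tsv_gen :: finite
  by standard (simp add: UNIV_tsv_gen)

text \<open>
  The free \<open>\<complex>[\<partial>]\<close>-module on \<open>L, M, Y\<close>, with scalar multiplication \<open>(*s)\<close>;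
  the basis vector of a generator \<open>i\<close> is \<open>axis i 1\<close>.
\<close>

type_synonym tsv = "(complex poly, tsv_gen) vec"

lemma module_tsv: "module ((*s) :: complex poly \<Rightarrow> tsv \<Rightarrow> tsv)"
  by standard
    (simp_all add: vector_add_ldistrib vector_sadd_rdistrib vector_smult_assoc)

text \<open>\<open>aff s t i\<close> is \<open>(\<partial> + s\<lambda> + t) i\<close> for a generator \<open>i\<close>.\<close>

definition aff :: "complex \<Rightarrow> complex \<Rightarrow> tsv_gen \<Rightarrow> tsv poly" where
  "aff s t i = [: [:t, 1:] *s axis i 1, [:s:] *s axis i 1 :]"

fun gen_bracket ::
    "complex \<Rightarrow> complex \<Rightarrow> complex \<Rightarrow> complex \<Rightarrow> complex \<Rightarrow> complex \<Rightarrow> tsv_gen \<Rightarrow> tsv_gen \<Rightarrow> tsv poly"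
where
  "gen_bracket \<alpha>1 \<alpha>2 \<beta>1 \<beta>2 \<gamma>1 \<gamma>2 L L = aff 2 0 L"
| "gen_bracket \<alpha>1 \<alpha>2 \<beta>1 \<beta>2 \<gamma>1 \<gamma>2 L Y = aff \<alpha>1 \<alpha>2 Y"
| "gen_bracket \<alpha>1 \<alpha>2 \<beta>1 \<beta>2 \<gamma>1 \<gamma>2 L M = aff \<beta>1 \<beta>2 M"
| "gen_bracket \<alpha>1 \<alpha>2 \<beta>1 \<beta>2 \<gamma>1 \<gamma>2 Y Y = aff \<gamma>1 \<gamma>2 M"
| "gen_bracket \<alpha>1 \<alpha>2 \<beta>1 \<beta>2 \<gamma>1 \<gamma>2 Y M = 0"
| "gen_bracket \<alpha>1 \<alpha>2 \<beta>1 \<beta>2 \<gamma>1 \<gamma>2 M M = 0"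
| "gen_bracket \<alpha>1 \<alpha>2 \<beta>1 \<beta>2 \<gamma>1 \<gamma>2 Y L = - subst_skew (*s) (aff \<alpha>1 \<alpha>2 Y)"
| "gen_bracket \<alpha>1 \<alpha>2 \<beta>1 \<beta>2 \<gamma>1 \<gamma>2 M L = - subst_skew (*s) (aff \<beta>1 \<beta>2 M)"
| "gen_bracket \<alpha>1 \<alpha>2 \<beta>1 \<beta>2 \<gamma>1 \<gamma>2 M Y = - subst_skew (*s) 0"

text \<open>\<open>poly_act T p v\<close> is \<open>p(T) v\<close> for a \<open>\<complex>\<close>-linear operator \<open>T\<close> on \<open>TSV[\<lambda>]\<close>.\<close>

definition poly_act :: "(tsv poly \<Rightarrow> tsv poly) \<Rightarrow> complex poly \<Rightarrow> tsv poly \<Rightarrow> tsv poly" where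
  "poly_act T p v = poly_subst (\<lambda>c. coeff_scale (*s) [:c:] v) T p"

text \<open>
  Sesquilinear extension:
  \<open>[p(\<partial>)i \<^sub>\<lambda> q(\<partial>)j] = p(-\<lambda>) q(\<lambda> + \<partial>) [i \<^sub>\<lambda> j]\<close> for generators \<open>i, j\<close>.
\<close>

definition tsv_bracket ::
    "complex \<Rightarrow> complex \<Rightarrow> complex \<Rightarrow> complex \<Rightarrow> complex \<Rightarrow> complex \<Rightarrow> tsv \<Rightarrow> tsv \<Rightarrow> tsv poly" where
  "tsv_bracket \<alpha>1 \<alpha>2 \<beta>1 \<beta>2 \<gamma>1 \<gamma>2 a b =
     (\<Sum>i\<in>UNIV. \<Sum>j\<in>UNIV.
        poly_act (\<lambda>g. - pCons 0 g) (a $ i)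
          (poly_act (\<lambda>g. pCons 0 g + coeff_scale (*s) [:0, 1:] g) (b $ j)
            (gen_bracket \<alpha>1 \<alpha>2 \<beta>1 \<beta>2 \<gamma>1 \<gamma>2 i j)))"

subsection \<open>The bracket is the \<open>\<complex>\<close>-bilinear sesquilinear extension of its values on generators\<close>

lemma coeff_coeff_scale [simp]:
  "coeff (coeff_scale (*s) p g) n = p *s coeff (g :: tsv poly) n"
  by (simp add: coeff_scale_def coeff_map_poly)

lemma poly_subst_bound:
  assumes "\<iota> 0 = 0" "T 0 = 0" "degree f \<le> N"
  shows "poly_subst \<iota> T f = (\<Sum>k\<le>N. (T ^^ k) (\<iota> (coeff f k)))"
proof -
  have T0: "(T ^^ k) 0 = 0" for k
    by (induction k) (simp_all add: assms)
  show ?thesis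
    unfolding poly_subst_def using assms T0
    by (intro sum.mono_neutral_left) (auto simp: coeff_eq_0)
qed

lemma funpow_add_hom:
  fixes T :: "'a::ab_group_add \<Rightarrow> 'a"
  assumes "\<And>x y. T (x + y) = T x + T y"
  shows "(T ^^ k) (x + y) = (T ^^ k) x + (T ^^ k) y"
  by (induction k) (simp_all add: assms)

lemma coeff_scale_add:
  "coeff_scale (*s) p (v + w) = coeff_scale (*s) p v + coeff_scale (*s) p (w :: tsv poly)"
  by (simp add: poly_eq_iff vector_add_ldistrib)

lemma coeff_scale_add_left:
  "coeff_scale (*s) (p + q) v = coeff_scale (*s) p v + coeff_scale (*s) q (v :: tsv poly)"
  by (simp add: poly_eq_iff vector_sadd_rdistrib)

lemma coeff_scale_scale:
  "coeff_scale (*s) p (coeff_scale (*s) q v) = coeff_scale (*s) (p * q) (v :: tsv poly)"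
  by (simp add: poly_eq_iff vector_smult_assoc)

lemma coeff_scale_pCons:
  "coeff_scale (*s) p (pCons 0 v) = pCons 0 (coeff_scale (*s) p (v :: tsv poly))"
  by (simp add: poly_eq_iff coeff_pCons split: nat.split)

lemma coeff_scale_minus:
  "coeff_scale (*s) p (- v) = - coeff_scale (*s) p (v :: tsv poly)"
  by (simp add: poly_eq_iff vector_smult_rneg)

lemma coeff_scale_0_left [simp]: "coeff_scale (*s) 0 (v :: tsv poly) = 0"
  by (simp add: poly_eq_iff)

lemma coeff_scale_1_left [simp]: "coeff_scale (*s) 1 (v :: tsv poly) = v"
  by (simp add: poly_eq_iff)

lemma poly_subst_pCons_0:
  fixes T :: "'b::ab_group_add \<Rightarrow> 'b"
  assumes T: "\<And>x y. T (x + y) = T x + T y" and "\<iota> 0 = 0"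
  shows "poly_subst \<iota> T (pCons 0 f) = T (poly_subst \<iota> T f)"
proof -
  have T0: "T 0 = 0" using T[of 0 0] by simp
  have "poly_subst \<iota> T (pCons 0 f)
      = (\<Sum>k\<le>Suc (degree f). (T ^^ k) (\<iota> (coeff (pCons 0 f) k)))"
    using assms T0 degree_pCons_le[of 0 f] by (intro poly_subst_bound) auto
  also have "\<dots> = (\<Sum>k\<le>degree f. T ((T ^^ k) (\<iota> (coeff f k))))"
    by (simp only: sum.atMost_Suc_shift) (simp add: assms(2))
  also have "\<dots> = T (poly_subst \<iota> T f)"
    unfolding poly_subst_def using sum_comp_morphism[of T, OF T0 T] by (simp add: o_def)
  finally show ?thesis .
qed

lemma poly_act_0 [simp]: "poly_act T 0 v = 0"
  by (simp add: poly_act_def poly_subst_def)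

lemma poly_act_1 [simp]: "poly_act T 1 v = v"
  by (simp add: poly_act_def poly_subst_def flip: one_pCons)

lemma poly_act_add:
  assumes "\<And>x y. T (x + y) = T x + T y"
  shows "poly_act T p (v + w) = poly_act T p v + poly_act T p w"
  unfolding poly_act_def poly_subst_def
  by (simp add: coeff_scale_add funpow_add_hom[of T, OF assms] sum.distrib)

lemma poly_act_add_left:
  assumes "\<And>x y. T (x + y) = T x + T y"
  shows "poly_act T (p + q) v = poly_act T p v + poly_act T q v"
proof -
  define N where "N = max (degree p) (degree q)"
  have T0: "T 0 = 0" using assms[of 0 0] by simp
  have *: "poly_act T r v = (\<Sum>k\<le>N. (T ^^ k) (coeff_scale (*s) [:coeff r k:] v))"
    if "degree r \<le> N" for r
    unfolding poly_act_def by (rule poly_subst_bound) (use T0 that in auto)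
  have "[:coeff (p + q) k:] = [:coeff p k:] + [:coeff q k:]" for k
    by simp
  then show ?thesis
    using degree_add_le_max[of p q]
    by (simp only: * N_def max.cobounded1 max.cobounded2 coeff_scale_add_left
        funpow_add_hom[of T, OF assms] sum.distrib)
qed

lemma poly_act_commute:
  assumes "\<And>x y. T (x + y) = T x + T y" "\<And>x y. S (x + y) = S x + S y"
    and "\<And>x. S (T x) = T (S x)"
    and "\<And>c x. S (coeff_scale (*s) [:c:] x) = coeff_scale (*s) [:c:] (S x)"
  shows "S (poly_act T p v) = poly_act T p (S v)"
proof -
  have S0: "S 0 = 0" using assms(2)[of 0 0] by simp
  have *: "S ((T ^^ k) x) = (T ^^ k) (S x)" for k x
    by (induction k) (simp_all add: assms)
  have sum_S: "S (sum f A) = (\<Sum>k\<in>A. S (f k))" for f and A :: "nat set"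
    using sum_comp_morphism[of S f A, OF S0 assms(2)] by (simp add: o_def)
  show ?thesis
    unfolding poly_act_def poly_subst_def sum_S by (simp add: * assms(4))
qed

lemma poly_act_const:
  assumes "\<And>x y. T (x + y) = T x + T y"
    and "\<And>c x. T (coeff_scale (*s) [:c:] x) = coeff_scale (*s) [:c:] (T x)"
  shows "poly_act T ([:z:] * p) v = coeff_scale (*s) [:z:] (poly_act T p v)"
proof -
  have T0: "T 0 = 0" using assms(1)[of 0 0] by simp
  have "poly_act T ([:z:] * p) v = poly_act T p (coeff_scale (*s) [:z:] v)"
    unfolding poly_act_def
    by (subst poly_subst_bound[where N = "degree p"])
      (auto simp: T0 poly_subst_def coeff_scale_scale degree_smult_le mult.commute)
  then show ?thesis
    using assms
    by (subst poly_act_commute) (auto simp: coeff_scale_add coeff_scale_scale mult.commute)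
qed

lemma tsv_op_left:
  "(\<lambda>g. - pCons 0 g) (v + w :: tsv poly) = (\<lambda>g. - pCons 0 g) v + (\<lambda>g. - pCons 0 g) w"
  "(\<lambda>g. - pCons 0 g) (coeff_scale (*s) p v) = coeff_scale (*s) p ((\<lambda>g. - pCons 0 g) v)"
  by (simp_all add: coeff_scale_pCons coeff_scale_minus)

lemma tsv_op_right:
  fixes v w :: "tsv poly"
  defines "T \<equiv> (\<lambda>g. pCons 0 g + coeff_scale (*s) [:0, 1:] g)"
  shows "T (v + w) = T v + T w" "T (coeff_scale (*s) p v) = coeff_scale (*s) p (T v)"
    "T (- pCons 0 v) = - pCons 0 (T v)"
proof -
  have "pCons 0 (v + w) = pCons 0 v + pCons 0 w"
    by simp
  then show "T (v + w) = T v + T w"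
    by (simp add: T_def coeff_scale_add)
  show "T (coeff_scale (*s) p v) = coeff_scale (*s) p (T v)"
    by (simp add: T_def coeff_scale_add coeff_scale_scale coeff_scale_pCons mult.commute)
  show "T (- pCons 0 v) = - pCons 0 (T v)"
    by (simp add: T_def poly_eq_iff coeff_pCons vector_smult_rneg split: nat.split)
qed

lemma tsv_bracket_axis:
  "tsv_bracket \<alpha>1 \<alpha>2 \<beta>1 \<beta>2 \<gamma>1 \<gamma>2 (axis i 1) (axis j 1)
     = gen_bracket \<alpha>1 \<alpha>2 \<beta>1 \<beta>2 \<gamma>1 \<gamma>2 i j"
proof -
  have T0: "poly_act (\<lambda>g. - pCons 0 g) p 0 = 0" for p
    using poly_act_add[of "\<lambda>g. - pCons 0 g" p 0 0] tsv_op_left(1) by simp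
  have "tsv_bracket \<alpha>1 \<alpha>2 \<beta>1 \<beta>2 \<gamma>1 \<gamma>2 (axis i 1) (axis j 1)
    = (\<Sum>i'\<in>UNIV. \<Sum>j'\<in>UNIV. if j' = j then if i' = i
        then gen_bracket \<alpha>1 \<alpha>2 \<beta>1 \<beta>2 \<gamma>1 \<gamma>2 i j else 0 else 0)"
    unfolding tsv_bracket_def by (intro sum.cong) (auto simp: axis_def T0)
  also have "\<dots> = gen_bracket \<alpha>1 \<alpha>2 \<beta>1 \<beta>2 \<gamma>1 \<gamma>2 i j"
    by simp
  finally show ?thesis .
qed

lemma tsv_bracket_add:
  "tsv_bracket \<alpha>1 \<alpha>2 \<beta>1 \<beta>2 \<gamma>1 \<gamma>2 (a + b) c
     = tsv_bracket \<alpha>1 \<alpha>2 \<beta>1 \<beta>2 \<gamma>1 \<gamma>2 a c + tsv_bracket \<alpha>1 \<alpha>2 \<beta>1 \<beta>2 \<gamma>1 \<gamma>2 b c"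
  "tsv_bracket \<alpha>1 \<alpha>2 \<beta>1 \<beta>2 \<gamma>1 \<gamma>2 a (b + c)
     = tsv_bracket \<alpha>1 \<alpha>2 \<beta>1 \<beta>2 \<gamma>1 \<gamma>2 a b + tsv_bracket \<alpha>1 \<alpha>2 \<beta>1 \<beta>2 \<gamma>1 \<gamma>2 a c"
  unfolding tsv_bracket_def
  by (simp_all only: vector_add_component poly_act_add_left poly_act_add tsv_op_left(1)
      tsv_op_right(1) sum.distrib)

lemma coeff_scale_sum:
  "coeff_scale (*s) p (sum f A) = (\<Sum>i\<in>A. coeff_scale (*s) p (f i :: tsv poly))"
  by (induction A rule: infinite_finite_induct) (simp_all add: coeff_scale_add, simp_all add: poly_eq_iff)

lemma tsv_bracket_const:
  "tsv_bracket \<alpha>1 \<alpha>2 \<beta>1 \<beta>2 \<gamma>1 \<gamma>2 ([:z:] *s a) b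
     = coeff_scale (*s) [:z:] (tsv_bracket \<alpha>1 \<alpha>2 \<beta>1 \<beta>2 \<gamma>1 \<gamma>2 a b)"
  "tsv_bracket \<alpha>1 \<alpha>2 \<beta>1 \<beta>2 \<gamma>1 \<gamma>2 a ([:z:] *s b)
     = coeff_scale (*s) [:z:] (tsv_bracket \<alpha>1 \<alpha>2 \<beta>1 \<beta>2 \<gamma>1 \<gamma>2 a b)"
proof -
  have comm: "poly_act (\<lambda>g. - pCons 0 g) p (coeff_scale (*s) [:z:] v)
      = coeff_scale (*s) [:z:] (poly_act (\<lambda>g. - pCons 0 g) p v)" for p v
    by (rule poly_act_commute[symmetric])
      (simp_all only: tsv_op_left coeff_scale_add coeff_scale_scale mult.commute)
  show "tsv_bracket \<alpha>1 \<alpha>2 \<beta>1 \<beta>2 \<gamma>1 \<gamma>2 ([:z:] *s a) b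
     = coeff_scale (*s) [:z:] (tsv_bracket \<alpha>1 \<alpha>2 \<beta>1 \<beta>2 \<gamma>1 \<gamma>2 a b)"
    unfolding tsv_bracket_def
    by (simp only: vector_smult_component poly_act_const tsv_op_left coeff_scale_sum)
  show "tsv_bracket \<alpha>1 \<alpha>2 \<beta>1 \<beta>2 \<gamma>1 \<gamma>2 a ([:z:] *s b)
     = coeff_scale (*s) [:z:] (tsv_bracket \<alpha>1 \<alpha>2 \<beta>1 \<beta>2 \<gamma>1 \<gamma>2 a b)"
    unfolding tsv_bracket_def
    by (simp only: vector_smult_component poly_act_const tsv_op_right coeff_scale_sum comm)
qed

lemma poly_act_del:
  assumes "\<And>x y. T (x + y) = T x + T y"
  shows "poly_act T ([:0, 1:] * p) v = T (poly_act T p v)"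
  unfolding poly_act_def
  using poly_subst_pCons_0[of T "\<lambda>c. coeff_scale (*s) [:c:] v", OF assms] by simp

lemma tsv_bracket_sesquilinear:
  "tsv_bracket \<alpha>1 \<alpha>2 \<beta>1 \<beta>2 \<gamma>1 \<gamma>2 ([:0, 1:] *s a) b
     = - pCons 0 (tsv_bracket \<alpha>1 \<alpha>2 \<beta>1 \<beta>2 \<gamma>1 \<gamma>2 a b)"
  "tsv_bracket \<alpha>1 \<alpha>2 \<beta>1 \<beta>2 \<gamma>1 \<gamma>2 a ([:0, 1:] *s b)
     = pCons 0 (tsv_bracket \<alpha>1 \<alpha>2 \<beta>1 \<beta>2 \<gamma>1 \<gamma>2 a b)
       + coeff_scale (*s) [:0, 1:] (tsv_bracket \<alpha>1 \<alpha>2 \<beta>1 \<beta>2 \<gamma>1 \<gamma>2 a b)"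
proof -
  define S :: "tsv poly \<Rightarrow> tsv poly" where "S = (\<lambda>g. - pCons 0 g)"
  define T :: "tsv poly \<Rightarrow> tsv poly" where "T = (\<lambda>g. pCons 0 g + coeff_scale (*s) [:0, 1:] g)"
  have S: "S (v + w) = S v + S w" "S (coeff_scale (*s) p v) = coeff_scale (*s) p (S v)"
    for v w p
    unfolding S_def using tsv_op_left by blast+
  have T: "T (v + w) = T v + T w" "T (coeff_scale (*s) p v) = coeff_scale (*s) p (T v)"
    "T (S v) = S (T v)" for v w p
    unfolding T_def S_def using tsv_op_right by blast+
  have sum: "U (sum f A) = (\<Sum>i\<in>A. U (f i))" if "\<And>v w. U (v + w) = U v + U w"
    for U :: "tsv poly \<Rightarrow> tsv poly" and f and A :: "tsv_gen set"
    using sum_comp_morphism[of U f A] that that[of 0 0] by (simp add: o_def)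
  note SS = sum[of S, OF S(1)] and ST = sum[of T, OF T(1)]
  have comm: "poly_act S p (T v) = T (poly_act S p v)" for p v
    by (rule poly_act_commute[symmetric]) (simp_all only: S T)
  show "tsv_bracket \<alpha>1 \<alpha>2 \<beta>1 \<beta>2 \<gamma>1 \<gamma>2 ([:0, 1:] *s a) b
     = - pCons 0 (tsv_bracket \<alpha>1 \<alpha>2 \<beta>1 \<beta>2 \<gamma>1 \<gamma>2 a b)"
    unfolding tsv_bracket_def S_def[symmetric] T_def[symmetric]
    unfolding fun_cong[OF S_def, symmetric]
    by (simp only: vector_smult_component poly_act_del S SS)
  show "tsv_bracket \<alpha>1 \<alpha>2 \<beta>1 \<beta>2 \<gamma>1 \<gamma>2 a ([:0, 1:] *s b)
     = pCons 0 (tsv_bracket \<alpha>1 \<alpha>2 \<beta>1 \<beta>2 \<gamma>1 \<gamma>2 a b)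
       + coeff_scale (*s) [:0, 1:] (tsv_bracket \<alpha>1 \<alpha>2 \<beta>1 \<beta>2 \<gamma>1 \<gamma>2 a b)"
    unfolding tsv_bracket_def S_def[symmetric] T_def[symmetric]
    unfolding fun_cong[OF T_def, symmetric]
    by (simp only: vector_smult_component poly_act_del T ST comm)
qed

end

theory Submission
  imports Defs
begin

text \<open>
  Polynomials over \<open>\<complex>\<close> are determined by their values, so all identities may be checked after
  evaluating \<open>\<lambda>\<close>, \<open>\<mu>\<close> and \<open>\<partial>\<close> at complex numbers \<open>l\<close>, \<open>m\<close>, \<open>d\<close>. The bracket of \<open>a = \<Sum>\<^sub>i a\<^sub>i(\<partial>) i\<close>
  and \<open>b = \<Sum>\<^sub>j b\<^sub>j(\<partial>) j\<close> becomes \<open>\<Sum>\<^sub>i\<^sub>j a\<^sub>i(-l) b\<^sub>j(l + d) [i \<^sub>l j](d)\<close>, and in each term of the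
  Jacobi identity for \<open>a, b, c\<close> the factor \<open>a\<^sub>i(-l) b\<^sub>p(-m) c\<^sub>q(l + m + d)\<close> splits off. Hence skew-symmetry
  and the Jacobi identity reduce to generators. Skew-symmetry for \<open>Y, Y\<close> forces \<open>\<gamma>1 = 2\<close> and
  \<open>\<gamma>2 = 0\<close>; the Jacobi identity for \<open>L, Y, Y\<close> then forces the conditions on \<open>\<beta>1\<close> and \<open>\<beta>2\<close>.
\<close>

section \<open>Evaluating polynomials through additive maps on coefficients\<close>

definition map_eval :: "('a::zero \<Rightarrow> complex) \<Rightarrow> complex \<Rightarrow> 'a poly \<Rightarrow> complex" where
  "map_eval \<phi> x f = poly (map_poly \<phi> f) x"

text \<open>\<open>\<phi>\<close> may kill leading coefficients, so the degree of
  \<open>map_poly \<phi> f\<close> can drop; the surplus terms vanish.\<close>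

lemma map_eval_altdef:
  assumes "\<phi> 0 = 0"
  shows "map_eval \<phi> x f = (\<Sum>n\<le>degree f. \<phi> (coeff f n) * x ^ n)"
proof -
  have "degree (map_poly \<phi> f) \<le> degree f"
    by (rule degree_le) (simp add: coeff_map_poly assms coeff_eq_0)
  have "map_eval \<phi> x f = (\<Sum>n\<le>degree (map_poly \<phi> f). \<phi> (coeff f n) * x ^ n)"
    by (simp add: map_eval_def poly_altdef coeff_map_poly assms)
  also have "\<dots> = (\<Sum>n\<le>degree f. \<phi> (coeff f n) * x ^ n)"
    using \<open>degree (map_poly \<phi> f) \<le> degree f\<close>
    by (intro sum.mono_neutral_left) (auto simp: coeff_eq_0 simp flip: coeff_map_poly[of \<phi>, OF assms])
  finally show ?thesis .
qed

lemma map_eval_pCons [simp]: "\<phi> 0 = 0 \<Longrightarrow> map_eval \<phi> x (pCons a f) = \<phi> a + x * map_eval \<phi> x f"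
  by (simp add: map_eval_def map_poly_pCons)

lemma map_eval_0 [simp]: "map_eval \<phi> x 0 = 0"
  by (simp add: map_eval_def)

text \<open>Additivity makes sense on a module and passes to polynomials over it, so
  \<open>map_eval\<close> can be iterated, first for \<lambda> and then for \<mu>.\<close>

lemma additive_map_eval:
  assumes "additive \<phi>"
  shows "additive (map_eval \<phi> x)"
proof
  fix f g :: "'a poly"
  have "map_poly \<phi> (f + g) = map_poly \<phi> f + map_poly \<phi> g"
    by (rule poly_eqI) (simp add: coeff_map_poly additive.zero[OF assms] additive.add[OF assms])
  then show "map_eval \<phi> x (f + g) = map_eval \<phi> x f + map_eval \<phi> x g"
    by (simp add: map_eval_def)
qed

lemma map_eval_map_poly:
  "\<lbrakk>\<phi> 0 = 0; T 0 = 0\<rbrakk> \<Longrightarrow> map_eval \<phi> x (map_poly T f) = map_eval (\<lambda>y. \<phi> (T y)) x f"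
  by (simp add: map_eval_def map_poly_map_poly o_def)

lemma map_eval_mult_left: "map_eval (\<lambda>y. c * \<phi> y) x f = c * map_eval \<phi> x f" if "\<phi> 0 = 0"
  using that by (simp add: map_eval_altdef sum_distrib_left mult.assoc)

lemma map_eval_mult_right: "map_eval (\<lambda>y. \<phi> y * c) x f = map_eval \<phi> x f * c" if "\<phi> 0 = 0"
  using map_eval_mult_left[of \<phi> c x f] that by (simp add: mult.commute)

lemma map_eval_sum:
  assumes "\<And>i. \<phi> i 0 = 0"
  shows "map_eval (\<lambda>y. \<Sum>i\<in>A. \<phi> i y) x f = (\<Sum>i\<in>A. map_eval (\<phi> i) x f)"
  by (simp add: map_eval_altdef assms sum_distrib_right) (rule sum.swap)

text \<open>\<open>\<phi>\<close> turns \<open>T\<close> into multiplication by \<open>t\<close>, so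
  substituting the operator becomes evaluation at a number. This handles all substitutions in the
  axioms.\<close>

lemma eval_poly_subst:
  assumes "additive \<phi>" and "\<phi> (\<iota> 0) = 0" and "\<And>g. \<phi> (T g) = t * \<phi> g"
  shows "\<phi> (poly_subst \<iota> T f) = map_eval (\<lambda>x. \<phi> (\<iota> x)) t f"
proof -
  have "\<phi> ((T ^^ k) g) = t ^ k * \<phi> g" for k g
    by (induction k) (simp_all add: assms(3))
  then show ?thesis
    by (simp add: poly_subst_def additive.sum[OF assms(1)] map_eval_altdef assms(2) mult.commute)
qed

section \<open>Evaluation of \<partial>, \<lambda> and \<mu> on \<open>TSV\<close>\<close>

definition ev1 :: "complex \<Rightarrow> tsv_gen \<Rightarrow> tsv \<Rightarrow> complex" where
  "ev1 d k v = poly (v $ k) d"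

definition ev2 :: "complex \<Rightarrow> complex \<Rightarrow> tsv_gen \<Rightarrow> tsv poly \<Rightarrow> complex" where
  "ev2 l d k = map_eval (ev1 d k) l"

text \<open>The outer variable is \<mu>, so \<open>m\<close> is inserted last.\<close>

definition ev3 :: "complex \<Rightarrow> complex \<Rightarrow> complex \<Rightarrow> tsv_gen \<Rightarrow> tsv poly poly \<Rightarrow> complex" where
  "ev3 m l d k = map_eval (ev2 l d k) m"

lemma additive_ev: "additive (ev1 d k)" "additive (ev2 l d k)" "additive (ev3 m l d k)"
proof -
  show 1: "additive (ev1 d k)" by standard (simp add: ev1_def)
  show 2: "additive (ev2 l d k)" unfolding ev2_def by (rule additive_map_eval[OF 1])
  show "additive (ev3 m l d k)" unfolding ev3_def by (rule additive_map_eval[OF 2])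
qed

lemmas ev_hom [simp] =
  additive_ev[THEN additive.add] additive_ev[THEN additive.zero]
  additive_ev[THEN additive.minus] additive_ev[THEN additive.diff]

lemma ev1_simps [simp]:
  "ev1 d k (p *s v) = poly p d * ev1 d k v"
  "ev1 d k (axis i 1) = (if i = k then 1 else 0)"
  by (auto simp: ev1_def axis_def)

lemma ev2_pCons [simp]: "ev2 l d k (pCons v f) = ev1 d k v + l * ev2 l d k f"
  by (simp add: ev2_def)

lemma ev2_coeff_scale [simp]: "ev2 l d k (coeff_scale (*s) p f) = poly p d * ev2 l d k f"
  by (simp add: ev2_def coeff_scale_def map_eval_map_poly map_eval_mult_left)

lemma ev2_poly_act:
  assumes "\<And>g. ev2 l d k (T g) = t * ev2 l d k g"
  shows "ev2 l d k (poly_act T p v) = poly p t * ev2 l d k v"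
  unfolding poly_act_def
  by (simp add: eval_poly_subst[of "ev2 l d k", OF additive_ev(2) _ assms] map_eval_mult_right)
    (simp add: map_eval_def)

lemma ev2_subst_skew [simp]: "ev2 l d k (subst_skew (*s) f) = ev2 (- l - d) d k f"
  unfolding subst_skew_def
  by (subst eval_poly_subst[where t = "- l - d"])
    (simp_all add: additive_ev algebra_simps, simp add: ev2_def)

lemma ev2_bracket:
  "ev2 l d k (tsv_bracket \<alpha>1 \<alpha>2 \<beta>1 \<beta>2 \<gamma>1 \<gamma>2 a b) =
    (\<Sum>i\<in>UNIV. \<Sum>j\<in>UNIV. ev1 (- l) i a * (ev1 (l + d) j b *
      ev2 l d k (gen_bracket \<alpha>1 \<alpha>2 \<beta>1 \<beta>2 \<gamma>1 \<gamma>2 i j)))"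
proof -
  have "ev2 l d k (poly_act (\<lambda>g. - pCons 0 g) p v) = poly p (- l) * ev2 l d k v" for p v
    by (rule ev2_poly_act) simp
  moreover have "ev2 l d k (poly_act (\<lambda>g. pCons 0 g + coeff_scale (*s) [:0, 1:] g) p v)
      = poly p (l + d) * ev2 l d k v" for p v
    by (rule ev2_poly_act) (simp add: algebra_simps)
  ultimately show ?thesis
    by (simp add: tsv_bracket_def additive.sum[OF additive_ev(2)] ev1_def)
qed

lemma ev3_simps [simp]:
  "ev3 m l d k (mul_mu g) = m * ev3 m l d k g"
  "ev3 m l d k (mul_lambda g) = l * ev3 m l d k g"
  "ev3 m l d k (in_lambda f) = ev2 l d k f"
  "ev3 m l d k (in_mu f) = ev2 m d k f"
  by (simp_all add: ev3_def mul_mu_def mul_lambda_def in_lambda_def in_mu_def map_eval_map_poly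
      map_eval_mult_left) (simp add: ev2_def)

lemma ev3_in_lambda_plus_mu [simp]: "ev3 m l d k (in_lambda_plus_mu f) = ev2 (l + m) d k f"
  unfolding in_lambda_plus_mu_def
  by (subst eval_poly_subst[where t = "l + m"])
    (simp_all add: additive_ev algebra_simps, simp add: ev2_def ev3_def)

text \<open>Complex polynomials with equal values are equal; this is used first for \<lambda>, then
  for \<partial>.\<close>

lemma tsv_poly_eq_iff: "f = g \<longleftrightarrow> (\<forall>l d k. ev2 l d k f = ev2 l d k g)"
proof
  assume *: "\<forall>l d k. ev2 l d k f = ev2 l d k g"
  have "map_poly (ev1 d k) f = map_poly (ev1 d k) g" for d k
    using * by (simp add: poly_eq_poly_eq_iff[symmetric] fun_eq_iff ev2_def map_eval_def)
  then have "ev1 d k (coeff f n) = ev1 d k (coeff g n)" for d k n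
    by (metis coeff_map_poly ev_hom(4))
  then have "coeff f n $ k = coeff g n $ k" for k n
    by (simp add: poly_eq_poly_eq_iff[symmetric] fun_eq_iff ev1_def)
  then show "f = g"
    by (simp add: poly_eq_iff vec_eq_iff)
qed simp

lemma tsv_poly_poly_eq_iff: "f = g \<longleftrightarrow> (\<forall>m l d k. ev3 m l d k f = ev3 m l d k g)"
proof
  assume *: "\<forall>m l d k. ev3 m l d k f = ev3 m l d k g"
  have "map_poly (ev2 l d k) f = map_poly (ev2 l d k) g" for l d k
    using * by (simp add: poly_eq_poly_eq_iff[symmetric] fun_eq_iff ev3_def map_eval_def)
  then have "ev2 l d k (coeff f n) = ev2 l d k (coeff g n)" for l d k n
    by (metis coeff_map_poly ev_hom(5))
  then show "f = g"
    by (simp add: poly_eq_iff[of f] tsv_poly_eq_iff)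
qed simp

section \<open>Reduction of the axioms to generators\<close>

lemma bracket_zero [simp]:
  "tsv_bracket \<alpha>1 \<alpha>2 \<beta>1 \<beta>2 \<gamma>1 \<gamma>2 0 b = 0" "tsv_bracket \<alpha>1 \<alpha>2 \<beta>1 \<beta>2 \<gamma>1 \<gamma>2 a 0 = 0"
  using tsv_bracket_add(1)[of \<alpha>1 \<alpha>2 \<beta>1 \<beta>2 \<gamma>1 \<gamma>2 0 0 b]
    tsv_bracket_add(2)[of \<alpha>1 \<alpha>2 \<beta>1 \<beta>2 \<gamma>1 \<gamma>2 a 0 0] by simp_all

context
  fixes \<alpha>1 \<alpha>2 \<beta>1 \<beta>2 \<gamma>1 \<gamma>2 :: complex
begin

abbreviation (input) br :: "tsv \<Rightarrow> tsv \<Rightarrow> tsv poly" where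
  "br \<equiv> tsv_bracket \<alpha>1 \<alpha>2 \<beta>1 \<beta>2 \<gamma>1 \<gamma>2"

text \<open>The structure polynomials: the coefficient of \<open>k\<close> in the bracket of
  \<open>i\<close> and \<open>j\<close>, at \<lambda> = \<open>l\<close> and \<partial> =
  \<open>d\<close>.\<close>

definition gen_coeff :: "complex \<Rightarrow> complex \<Rightarrow> tsv_gen \<Rightarrow> tsv_gen \<Rightarrow> tsv_gen \<Rightarrow> complex" where
  "gen_coeff l d k i j = ev2 l d k (gen_bracket \<alpha>1 \<alpha>2 \<beta>1 \<beta>2 \<gamma>1 \<gamma>2 i j)"

lemma ev2_br:
  "ev2 l d k (br a b) = (\<Sum>i\<in>UNIV. \<Sum>j\<in>UNIV. ev1 (- l) i a * (ev1 (l + d) j b * gen_coeff l d k i j))"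
  by (simp add: ev2_bracket gen_coeff_def)

text \<open>By sesquilinearity, \<partial> on the inner bracket acts as \<open>l + d\<close> or
  \<open>m + d\<close> when that bracket is the right argument, and as \<open>- (l + m)\<close> when
  it is the left one. These values replace \<open>d\<close> in the inner evaluation.\<close>

lemma ev3_br_br:
  "ev3 m l d k (poly_subst (\<lambda>x. in_lambda (br a x)) mul_mu f) =
    (\<Sum>i\<in>UNIV. \<Sum>j\<in>UNIV. ev1 (- l) i a * (ev2 m (l + d) j f * gen_coeff l d k i j))"
  "ev3 m l d k (poly_subst (\<lambda>x. in_lambda_plus_mu (br x c)) mul_lambda f) =
    (\<Sum>i\<in>UNIV. \<Sum>j\<in>UNIV. ev2 l (- (l + m)) i f * (ev1 (l + m + d) j c * gen_coeff (l + m) d k i j))"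
  "ev3 m l d k (poly_subst (\<lambda>x. in_mu (br b x)) mul_lambda f) =
    (\<Sum>i\<in>UNIV. \<Sum>j\<in>UNIV. ev1 (- m) i b * (ev2 l (m + d) j f * gen_coeff m d k i j))"
  by (simp_all add: eval_poly_subst[OF additive_ev(3), where T = mul_mu and t = m]
      eval_poly_subst[OF additive_ev(3), where T = mul_lambda and t = l]
      ev2_br map_eval_sum map_eval_mult_left map_eval_mult_right del: minus_add_distrib)
    (simp_all add: ev2_def)

text \<open>Replacing \<open>l\<close> by \<open>- l - d\<close> swaps the points \<open>- l\<close>
  and \<open>l + d\<close>, so both sides carry the same factors from \<open>a\<close> and
  \<open>b\<close>.\<close>

lemma skew_symmetry_iff:
  "(\<forall>a b. br a b = - subst_skew (*s) (br b a)) \<longleftrightarrow>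
    (\<forall>l d k i j. gen_coeff l d k i j = - gen_coeff (- l - d) d k j i)"
  (is "?L \<longleftrightarrow> ?R")
proof
  assume ?L
  then have "gen_bracket \<alpha>1 \<alpha>2 \<beta>1 \<beta>2 \<gamma>1 \<gamma>2 i j
      = - subst_skew (*s) (gen_bracket \<alpha>1 \<alpha>2 \<beta>1 \<beta>2 \<gamma>1 \<gamma>2 j i)" for i j
    by (metis tsv_bracket_axis)
  then show ?R
    unfolding gen_coeff_def by (metis ev_hom(8) ev2_subst_skew)
next
  assume R: ?R
  show ?L
  proof (intro allI, subst tsv_poly_eq_iff, intro allI)
    fix a b l d k
    have "ev2 l d k (br a b) =
        (\<Sum>i\<in>UNIV. \<Sum>j\<in>UNIV. - (ev1 (l + d) j b * (ev1 (- l) i a * gen_coeff (- l - d) d k j i)))"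
      unfolding ev2_br by (intro sum.cong refl) (subst R[rule_format], simp)
    also have "\<dots> = - ev2 (- l - d) d k (br b a)"
      unfolding ev2_br by (subst sum.swap) (simp add: sum_negf add.commute)
    finally show "ev2 l d k (br a b) = ev2 l d k (- subst_skew (*s) (br b a))"
      by simp
  qed
qed

lemma jacobi_iff:
  "(\<forall>a b c. poly_subst (\<lambda>x. in_lambda (br a x)) mul_mu (br b c)
         = poly_subst (\<lambda>x. in_lambda_plus_mu (br x c)) mul_lambda (br a b)
         + poly_subst (\<lambda>x. in_mu (br b x)) mul_lambda (br a c)) \<longleftrightarrow>
    (\<forall>l m d k i p q. (\<Sum>j\<in>UNIV. gen_coeff m (l + d) j p q * gen_coeff l d k i j) =
       (\<Sum>j\<in>UNIV. gen_coeff l (- (l + m)) j i p * gen_coeff (l + m) d k j q) +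
       (\<Sum>j\<in>UNIV. gen_coeff l (m + d) j i q * gen_coeff m d k p j))"
  (is "(\<forall>a b c. ?L a b c) \<longleftrightarrow> (\<forall>l m d k i p q. ?R l m d k i p q)")
proof -
  \<comment> \<open>The factor common to all three terms. In the middle one the inner bracket has
    \<open>- (l + m)\<close> for \<partial>, so \<open>b\<close> is evaluated at
    \<open>l - (l + m) = - m\<close>.\<close>
  define A where "A a b c l m d i p q = ev1 (- l) i a * ev1 (- m) p b * ev1 (l + m + d) q c"
    for a b c l m d i p q
  have *: "?L a b c \<longleftrightarrow> (\<forall>m l d k.
      (\<Sum>i\<in>UNIV. \<Sum>p\<in>UNIV. \<Sum>q\<in>UNIV. A a b c l m d i p q *
          (\<Sum>j\<in>UNIV. gen_coeff m (l + d) j p q * gen_coeff l d k i j)) =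
      (\<Sum>i\<in>UNIV. \<Sum>p\<in>UNIV. \<Sum>q\<in>UNIV. A a b c l m d i p q *
         ((\<Sum>j\<in>UNIV. gen_coeff l (- (l + m)) j i p * gen_coeff (l + m) d k j q) +
          (\<Sum>j\<in>UNIV. gen_coeff l (m + d) j i q * gen_coeff m d k p j))))" for a b c
    unfolding tsv_poly_poly_eq_iff ev_hom ev3_br_br ev2_br
    by (simp add: UNIV_tsv_gen A_def algebra_simps)
  show ?thesis
  proof
    assume L: "\<forall>a b c. ?L a b c"
    show "\<forall>l m d k i p q. ?R l m d k i p q"
    proof (intro allI)
      fix l m d k i p q
      \<comment> \<open>On basis vectors the factor is a Kronecker delta, which isolates one triple
        of generators.\<close>
      have A: "A (axis i 1) (axis p 1) (axis q 1) l m d i' p' q' =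
          (if q' = q then if p' = p then if i' = i then 1 else 0 else 0 else 0)" for i' p' q'
        by (simp add: A_def)
      show "?R l m d k i p q"
        using L[rule_format, of "axis i 1" "axis p 1" "axis q 1", unfolded *, rule_format, of l m d k]
        unfolding A by (simp add: if_distrib[of "\<lambda>x. x * _"] cong: if_cong)
    qed
  next
    assume R: "\<forall>l m d k i p q. ?R l m d k i p q"
    show "\<forall>a b c. ?L a b c"
      unfolding *
      by (intro allI sum.cong refl) (rule arg_cong[where f = "times _"], rule R[rule_format])
  qed
qed

text \<open>Bilinearity and sesquilinearity hold for all parameters by construction, which leaves
  skew-symmetry and Jacobi.\<close>

lemma lie_conformal_algebra_iff:
  "lie_conformal_algebra (*s) br \<longleftrightarrow>
    (\<forall>l d k i j. gen_coeff l d k i j = - gen_coeff (- l - d) d k j i) \<and>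
    (\<forall>l m d k i p q. (\<Sum>j\<in>UNIV. gen_coeff m (l + d) j p q * gen_coeff l d k i j) =
       (\<Sum>j\<in>UNIV. gen_coeff l (- (l + m)) j i p * gen_coeff (l + m) d k j q) +
       (\<Sum>j\<in>UNIV. gen_coeff l (m + d) j i q * gen_coeff m d k p j))"
  unfolding skew_symmetry_iff[symmetric] jacobi_iff[symmetric]
    lie_conformal_algebra_def lie_conformal_algebra_axioms_def
  by (simp only: module_tsv tsv_bracket_add tsv_bracket_const tsv_bracket_sesquilinear simp_thms)

section \<open>Solving for the parameters\<close>

lemma ev2_aff: "ev2 l d k (aff s t i) = (if i = k then d + s * l + t else 0)"
  by (simp add: aff_def)

lemma gen_coeff_simps:
  "gen_coeff l d k L L = (if k = L then d + 2 * l else 0)"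
  "gen_coeff l d k L Y = (if k = Y then d + \<alpha>1 * l + \<alpha>2 else 0)"
  "gen_coeff l d k L M = (if k = M then d + \<beta>1 * l + \<beta>2 else 0)"
  "gen_coeff l d k Y Y = (if k = M then d + \<gamma>1 * l + \<gamma>2 else 0)"
  "gen_coeff l d k Y M = 0" "gen_coeff l d k M M = 0" "gen_coeff l d k M Y = 0"
  "gen_coeff l d k Y L = (if k = Y then - (d + \<alpha>1 * (- l - d) + \<alpha>2) else 0)"
  "gen_coeff l d k M L = (if k = M then - (d + \<beta>1 * (- l - d) + \<beta>2) else 0)"
  by (auto simp: gen_coeff_def ev2_aff)

lemma lie_conformal_algebra_imp_params:
  assumes "lie_conformal_algebra (*s) br"
  shows "\<gamma>1 = 2 \<and> \<gamma>2 = 0 \<and> \<beta>2 = 2 * \<alpha>2 \<and> \<beta>1 = 2 * (\<alpha>1 - 1)"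
proof -
  from assms have skew: "gen_coeff l d k i j = - gen_coeff (- l - d) d k j i"
    and jac: "(\<Sum>j\<in>UNIV. gen_coeff m (l + d) j p q * gen_coeff l d k i j) =
       (\<Sum>j\<in>UNIV. gen_coeff l (- (l + m)) j i p * gen_coeff (l + m) d k j q) +
       (\<Sum>j\<in>UNIV. gen_coeff l (m + d) j i q * gen_coeff m d k p j)" for l m d k i j p q
    unfolding lie_conformal_algebra_iff by blast+
  \<comment> \<open>Both sides are affine in \<open>l\<close> and \<open>d\<close>; the points
    \<open>d = 1\<close> and \<open>d = 0\<close> with \<open>l = 0\<close> give \<gamma>1 and
    \<gamma>2.\<close>
  have "1 + \<gamma>2 = \<gamma>1 - (1 + \<gamma>2)"
    using skew[of 0 1 M Y Y] by (simp add: gen_coeff_simps)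
  moreover have "\<gamma>2 = 0"
    using skew[of 0 0 M Y Y] by (simp add: gen_coeff_simps)
  ultimately have \<gamma>: "\<gamma>2 = 0" "\<gamma>1 = 2"
    by auto
  \<comment> \<open>The component at \<open>M\<close> of the Jacobi identity for
    \<open>L, Y, Y\<close>; already \<open>m = 0\<close> determines \<beta>1 and \<beta>2.\<close>
  have J: "(d + l) * (d + \<beta>1 * l + \<beta>2) =
      (\<alpha>1 * l + \<alpha>2 - l) * (d + 2 * l) + (d + \<alpha>1 * l + \<alpha>2) * d" for l d
    using jac[where l=l and m=0 and d=d and k=M and i=L and p=Y and q=Y, unfolded UNIV_tsv_gen]
    by (simp add: gen_coeff_simps) (simp add: \<gamma> algebra_simps)
  \<comment> \<open>\<open>J\<close> takes \<open>d\<close> before \<open>l\<close>: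
    \<open>d = 1\<close>, \<open>l = 0\<close> gives \<beta>2, and \<open>d = 0\<close>,
    \<open>l = 1\<close> then gives \<beta>1.\<close>
  have "\<beta>2 = 2 * \<alpha>2"
    using J[of 1 0] by simp
  moreover from this have "\<beta>1 = 2 * (\<alpha>1 - 1)"
    using J[of 0 1] by (simp add: algebra_simps)
  ultimately show ?thesis using \<gamma> by blast
qed

(* The equations R may only be used after gen_coeff is unfolded: the parameters are
   implicit arguments of gen_coeff, where rewriting with R would block gen_coeff_simps. *)
lemma lie_conformal_algebra_if_params:
  assumes R: "\<gamma>1 = 2 \<and> \<gamma>2 = 0 \<and> \<beta>2 = 2 * \<alpha>2 \<and> \<beta>1 = 2 * (\<alpha>1 - 1)"
  shows "lie_conformal_algebra (*s) br"
  unfolding lie_conformal_algebra_iff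
proof (intro conjI allI)
  fix l d k i j
  show "gen_coeff l d k i j = - gen_coeff (- l - d) d k j i"
    by (cases i; cases j) (simp_all add: gen_coeff_simps, simp_all add: R algebra_simps)
next
  fix l m d k i p q
  show "(\<Sum>j\<in>UNIV. gen_coeff m (l + d) j p q * gen_coeff l d k i j) =
     (\<Sum>j\<in>UNIV. gen_coeff l (- (l + m)) j i p * gen_coeff (l + m) d k j q) +
     (\<Sum>j\<in>UNIV. gen_coeff l (m + d) j i q * gen_coeff m d k p j)"
    by (cases i; cases p; cases q; cases k)
      (simp_all add: gen_coeff_simps UNIV_tsv_gen, simp_all add: R algebra_simps)
qed

end

theorem theorem3p1:
  fixes \<alpha>1 \<alpha>2 \<beta>1 \<beta>2 \<gamma>1 \<gamma>2 :: complex
  shows "lie_conformal_algebra ((*s) :: complex poly \<Rightarrow> tsv \<Rightarrow> tsv)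
           (tsv_bracket \<alpha>1 \<alpha>2 \<beta>1 \<beta>2 \<gamma>1 \<gamma>2)
         \<longleftrightarrow> \<gamma>1 = 2 \<and> \<gamma>2 = 0 \<and> \<beta>2 = 2 * \<alpha>2 \<and> \<beta>1 = 2 * (\<alpha>1 - 1)"
  using lie_conformal_algebra_imp_params lie_conformal_algebra_if_params by blast

end
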